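(* Let $x_0\in(0,\infty)$ be such that $g(x_0)>0$. Put $\varepsilon_n=\sqrt{n^{-1}\log n}$ and $c_n = 1/\bigl(\sqrt{n\log n}+V_n(x_0)\bigr)^2$. Suppose that, as $n\to\infty$, (1) $V_n(x_0)\to V(x_0)$; (2) $n\left\{G_n\left(x_0+\frac{1}{\varepsilon^2 n\log n}\right)-G_n(x_0)\right\}\to 0$ for all $\varepsilon>0$; (3) $\int_{x_0}^{x_0+c_n}\frac{dG_n(y)}{\sqrt{y-x_0}} = o(\varepsilon_n)$; (4) $\frac{1}{\log n}\int_{x_0+c_n}^\infty\frac{dG_n(y)}{y-x_0}\to g(x_0)$. Then $\varepsilon_n^{-1}\{V_n^{\#}(x_0)-V_n(x_0)\}\Rightarrow N(0,g(x_0))$, where $\Rightarrow$ denotes convergence in distribution.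
   Context: Model: $\mathbf X=(X_1,X_2,X_3)$ is a random vector in $\mathbb R^3$ with a density of the form $\rho(x_1^2+x_2^2+x_3^2)$. $Y=X_1^2+X_2^2$ has distribution function $G$ with density $g(y)=\pi\int_y^\infty\frac{\rho(z)}{\sqrt{z-y}}\,dz$, and $V(y)=\int_y^\infty\frac{g(u)}{\sqrt{u-y}}\,du=\pi^2\int_y^\infty\rho(z)\,dz$. Triangular array: $G_n$, $n\ge1$, are (nonrandom) distribution functions on $[0,\infty)$; $T_1,T_2,\ldots$ are i.i.d. Uniform$(0,1)$; $Y_{n,i}=G_n^{-1}(T_i)$, $1\le i\le n$, where $G_n^{-1}(u)=\inf\{x: G_n(x)\ge u\}$ (so $Y_{n,1},\ldots,Y_{n,n}$ are i.i.d. with distribution function $G_n$). Define $$V_n(y)=\int_y^\infty\frac{dG_n(u)}{\sqrt{u-y}},\qquad V_n^{\#}(y)=\frac1n\sum_{i:\,Y_{n,i}>y}\frac1{\sqrt{Y_{n,i}-y}}.$$ Integrals $\int_y$ with respect to $dG_n$ are over points $u>y$. *)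

theory Defs
  imports "HOL-Probability.Probability" "HOL-Library.Landau_Symbols"
begin

text \<open>The density of \<open>X\<^sub>1\<^sup>2 + X\<^sub>2\<^sup>2\<close> when \<open>X\<close> has density \<open>\<rho> (x\<^sub>1\<^sup>2 + x\<^sub>2\<^sup>2 + x\<^sub>3\<^sup>2)\<close> on three-space, in the
  version given pointwise by this formula. The formula may diverge at some \<open>y\<close>; the Bochner integral
  is then \<open>0\<close>, so for \<open>\<rho> \<ge> 0\<close> the condition \<open>dens_g \<rho> y > 0\<close> includes convergence.\<close>

definition dens_g :: "(real \<Rightarrow> real) \<Rightarrow> real \<Rightarrow> real" where
  "dens_g \<rho> y = pi * (LBINT z:{y<..}. \<rho> z / sqrt (z - y))"

text \<open>For a density as above and \<open>y > 0\<close> this integral converges (it equals \<open>\<pi>\<^sup>2\<close> times the integral of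
  \<open>\<rho>\<close> over \<open>(y, \<infinity>)\<close>), so the real-valued integral loses nothing.\<close>

definition abel_V :: "(real \<Rightarrow> real) \<Rightarrow> real \<Rightarrow> real" where
  "abel_V \<rho> y = (LBINT u:{y<..}. dens_g \<rho> u / sqrt (u - y))"

definition distribution_function_nonneg :: "(real \<Rightarrow> real) \<Rightarrow> bool" where
  "distribution_function_nonneg F \<longleftrightarrow>
     mono F \<and> (\<forall>x. continuous (at_right x) F) \<and> (\<forall>x<0. F x = 0) \<and> (F \<longlongrightarrow> 1) at_top"

definition quantile :: "(real \<Rightarrow> real) \<Rightarrow> real \<Rightarrow> real" where
  "quantile F u = Inf {x. F x \<ge> u}"

text \<open>\<open>V\<^sub>n (y)\<close> for \<open>F = G\<^sub>n\<close>; it may be infinite, hence extended-valued. Once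
  \<open>V_ext (G n) x\<^sub>0\<close> converges to a finite limit, it is finite for all large \<open>n\<close> and \<open>V_real\<close> is its value.\<close>

definition V_ext :: "(real \<Rightarrow> real) \<Rightarrow> real \<Rightarrow> ennreal" where
  "V_ext F y = (\<integral>\<^sup>+u\<in>{y<..}. ennreal (1 / sqrt (u - y)) \<partial>interval_measure F)"

definition V_real :: "(real \<Rightarrow> real) \<Rightarrow> real \<Rightarrow> real" where
  "V_real F y = enn2real (V_ext F y)"

definition V_sharp :: "nat \<Rightarrow> (nat \<Rightarrow> real) \<Rightarrow> real \<Rightarrow> real" where
  "V_sharp n Y y = (1 / real n) * (\<Sum>i\<in>{i\<in>{1..n}. Y i > y}. 1 / sqrt (Y i - y))"

definition eps_seq :: "nat \<Rightarrow> real" where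
  "eps_seq n = sqrt (ln (real n) / real n)"

definition c_seq :: "(nat \<Rightarrow> real \<Rightarrow> real) \<Rightarrow> real \<Rightarrow> nat \<Rightarrow> real" where
  "c_seq G x0 n = 1 / (sqrt (real n * ln (real n)) + V_real (G n) x0)\<^sup>2"

end

theory Submission
  imports Defs
begin

text \<open>
  Write \<open>h(y) = 1 / sqrt (y - x0)\<close> for \<open>y > x0\<close> and \<open>h(y) = 0\<close> otherwise, and \<open>b n = sqrt (n ln n)\<close>.
  The standardised statistic is the row sum of the variables \<open>(h(Y) - V) / b n\<close>, where \<open>V\<close> is the mean
  of \<open>h(Y)\<close> and \<open>Y\<close> runs through \<open>n\<close> independent variables with distribution function \<open>G n\<close>
  (\<open>distr_quantile_uniform\<close>, \<open>V_sharp_eq_sum\<close>). The model case is a distribution with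
  positive continuous density near \<open>x0\<close>, for which \<open>h(Y)\<close> has a tail of order \<open>1 / u\<^sup>2\<close>: its
  variance is infinite, but its second moment truncated at level \<open>b n\<close> grows only like \<open>ln n\<close>. This is the
  borderline case in which the limit is still normal and the normalisation gains a factor
  \<open>sqrt (ln n)\<close>.

  The proof truncates \<open>h(Y)\<close> at \<open>b n + V\<close>. Hypothesis \<open>cond2\<close> bounds the tail of \<open>h(Y)\<close>. It makes
  truncation harmless, because with high probability no variable of the row is affected, and it
  implies Lindeberg's condition for the truncated variables. Hypothesis \<open>cond3\<close> says that truncation
  moves the mean of the row sum by \<open>o(1)\<close>; by \<open>cond4\<close>, and because \<open>cond1\<close> keeps \<open>V\<close> finite and bounded for large \<open>n\<close>, the
  variance of the truncated row sum tends to \<open>dens_g \<rho> x0\<close>. Hence the characteristic function of one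
  summand is \<open>1 - dens_g \<rho> x0 t\<^sup>2 / (2 n) + o(1/n)\<close> (\<open>char_limit_of_heavy_tailed_array\<close>,
  \<open>char_limit_abel_kernel\<close>), its \<open>n\<close>-th power tends to the characteristic function of the normal law,
  and Levy's continuity theorem finishes the argument (\<open>weak_conv_normal_row_iid\<close>).
\<close>

section \<open>Characteristic functions of small random variables\<close>

text \<open>The Taylor remainder of \<open>exp (\<i> t Z)\<close> is at most \<open>t\<^sup>2 min (Z\<^sup>2) (\<bar>t\<bar> \<bar>Z\<bar>\<^sup>3)\<close>. Where \<open>\<bar>Z\<bar>\<close>
  exceeds \<open>\<delta>\<close> the square is controlled by the bound \<open>K\<close>; elsewhere one factor of the cube is at most
  \<open>\<delta>\<close>. This is the trade-off behind Lindeberg's condition.\<close>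

lemma (in prob_space) char_second_order_bound:
  fixes Z :: "'a \<Rightarrow> real"
  assumes Z [measurable]: "random_variable borel Z"
    and bounded: "\<And>x. x \<in> space M \<Longrightarrow> \<bar>Z x\<bar> \<le> K" and \<delta>: "0 \<le> \<delta>"
  shows "cmod (char (distr M borel Z) t -
            (1 + \<i> * t * expectation Z - t\<^sup>2 / 2 * expectation (\<lambda>x. (Z x)\<^sup>2)))
         \<le> t\<^sup>2 * (K\<^sup>2 * prob {x \<in> space M. \<delta> < \<bar>Z x\<bar>} + \<bar>t\<bar> * \<delta> * expectation (\<lambda>x. (Z x)\<^sup>2))"
proof -
  interpret D: real_distribution "distr M borel Z"
    by (rule real_distribution_distr) simp
  have pow: "\<bar>Z x ^ k\<bar> \<le> K ^ k" if "x \<in> space M" for x k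
    using bounded[OF that] by (simp add: power_abs power_mono)
  have int: "integrable M (\<lambda>x. Z x ^ k)" for k
    by (rule integrable_const_bound[where B = "K ^ k"]) (auto simp: pow)
  have intmin: "integrable M (\<lambda>x. min (6 * (Z x)\<^sup>2) (\<bar>t\<bar> * \<bar>Z x\<bar> ^ 3))"
    by (rule Bochner_Integration.integrable_bound[of _ "\<lambda>x. 6 * (Z x)\<^sup>2"]) (auto simp: int)
  have intind: "integrable M (indicator {x \<in> space M. \<delta> < \<bar>Z x\<bar>} :: 'a \<Rightarrow> real)"
    by (rule integrable_real_indicator) (auto simp: emeasure_eq_measure)
  have intbound: "integrable M (\<lambda>x. 6 * K\<^sup>2 * indicator {x \<in> space M. \<delta> < \<bar>Z x\<bar>} x + \<bar>t\<bar> * \<delta> * (Z x)\<^sup>2)"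
    by (intro Bochner_Integration.integrable_add integrable_mult_right int intind)
  have pointwise: "min (6 * (Z x)\<^sup>2) (\<bar>t\<bar> * \<bar>Z x\<bar> ^ 3) \<le>
      6 * K\<^sup>2 * indicator {x \<in> space M. \<delta> < \<bar>Z x\<bar>} x + \<bar>t\<bar> * \<delta> * (Z x)\<^sup>2" if x: "x \<in> space M" for x
  proof (cases "\<delta> < \<bar>Z x\<bar>")
    case True
    have "0 \<le> \<bar>t\<bar> * \<delta> * (Z x)\<^sup>2" using \<delta> by simp
    then show ?thesis using True x pow[OF x, of 2] by simp
  next
    case False
    have "\<bar>t\<bar> * \<bar>Z x\<bar> ^ 3 = \<bar>t\<bar> * \<bar>Z x\<bar> * (Z x)\<^sup>2"
      by (simp add: power3_eq_cube power2_eq_square)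
    also have "\<dots> \<le> \<bar>t\<bar> * \<delta> * (Z x)\<^sup>2"
      using False by (intro mult_right_mono mult_left_mono) auto
    finally show ?thesis using False by simp
  qed
  have "cmod (char (distr M borel Z) t -
      (\<Sum>k\<le>2. ((\<i> * t) ^ k / fact k) * D.expectation (\<lambda>x. x ^ k)))
    \<le> \<bar>t\<bar>\<^sup>2 / fact (Suc 2) *
        D.expectation (\<lambda>x. min (2 * \<bar>x\<bar>\<^sup>2 * Suc 2) (\<bar>t\<bar> * \<bar>x\<bar> ^ Suc 2))"
    by (rule D.char_approx2) (simp add: integrable_distr_eq int)
  also have "(\<Sum>k\<le>2. ((\<i> * t) ^ k / fact k) * D.expectation (\<lambda>x. x ^ k)) =
      1 + \<i> * t * expectation Z - t\<^sup>2 / 2 * expectation (\<lambda>x. (Z x)\<^sup>2)"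
    by (simp add: numeral_2_eq_2 integral_distr power_mult_distrib prob_space D.prob_space)
  also have "\<bar>t\<bar>\<^sup>2 / fact (Suc 2) *
        D.expectation (\<lambda>x. min (2 * \<bar>x\<bar>\<^sup>2 * Suc 2) (\<bar>t\<bar> * \<bar>x\<bar> ^ Suc 2)) =
      t\<^sup>2 / 6 * expectation (\<lambda>x. min (6 * (Z x)\<^sup>2) (\<bar>t\<bar> * \<bar>Z x\<bar> ^ 3))"
    by (subst integral_distr) (auto simp: fact_numeral eval_nat_numeral mult_ac)
  also have "\<dots> \<le> t\<^sup>2 / 6 * expectation (\<lambda>x.
      6 * K\<^sup>2 * indicator {x \<in> space M. \<delta> < \<bar>Z x\<bar>} x + \<bar>t\<bar> * \<delta> * (Z x)\<^sup>2)"
    by (intro mult_left_mono integral_mono intmin intbound pointwise) auto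
  also have "\<dots> = t\<^sup>2 / 6 * (6 * K\<^sup>2 * prob {x \<in> space M. \<delta> < \<bar>Z x\<bar>} +
      \<bar>t\<bar> * \<delta> * expectation (\<lambda>x. (Z x)\<^sup>2))"
    by (subst Bochner_Integration.integral_add) (auto simp: int intind)
  also have "\<dots> \<le> t\<^sup>2 * (K\<^sup>2 * prob {x \<in> space M. \<delta> < \<bar>Z x\<bar>} + \<bar>t\<bar> * \<delta> * expectation (\<lambda>x. (Z x)\<^sup>2))"
  proof -
    have "0 \<le> t\<^sup>2 * (\<bar>t\<bar> * \<delta> * expectation (\<lambda>x. (Z x)\<^sup>2))" using \<delta> by simp
    then show ?thesis by (simp add: algebra_simps)
  qed
  finally show ?thesis .
qed

lemma (in prob_space) cmod_char_diff_le_prob_neq: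
  fixes W U :: "'a \<Rightarrow> real"
  assumes [measurable]: "random_variable borel W" "random_variable borel U"
  shows "cmod (char (distr M borel W) t - char (distr M borel U) t)
           \<le> 2 * prob {x \<in> space M. W x \<noteq> U x}"
proof -
  have I: "integrable M (\<lambda>x. iexp (t * V x))" if [measurable]: "random_variable borel V" for V
    by (rule integrable_const_bound[where B = 1]) auto
  have int_neq: "integrable M (indicator {x \<in> space M. W x \<noteq> U x} :: 'a \<Rightarrow> real)"
    by (rule integrable_real_indicator) (auto simp: emeasure_eq_measure)
  have "char (distr M borel W) t - char (distr M borel U) t =
      (CLINT x|M. iexp (t * W x) - iexp (t * U x))"
    using I[OF assms(1)] I[OF assms(2)] by (simp add: char_def integral_distr)
  also have "cmod \<dots> \<le> (LINT x|M. 2 * indicator {x \<in> space M. W x \<noteq> U x} x)"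
  proof (rule order_trans[OF integral_norm_bound integral_mono])
    fix x assume "x \<in> space M"
    show "cmod (iexp (t * W x) - iexp (t * U x)) \<le> 2 * indicator {x \<in> space M. W x \<noteq> U x} x"
    proof (cases "W x = U x")
      case False
      have "cmod (iexp (t * W x) - iexp (t * U x)) \<le> cmod (iexp (t * W x)) + cmod (iexp (t * U x))"
        by (rule norm_triangle_ineq4)
      then show ?thesis using False \<open>x \<in> space M\<close> by simp
    qed simp
  next
    show "integrable M (\<lambda>x. cmod (iexp (t * W x) - iexp (t * U x)))"
      by (intro integrable_norm Bochner_Integration.integrable_diff I) auto
  qed (use int_neq in auto)
  finally show ?thesis by simp
qed

text \<open>The comparison is with \<open>(1 - c / n) ^ n\<close>. As \<open>c \<ge> 0\<close>, both bases lie in the unit disc once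
  \<open>n \<ge> c\<close>, so the distance of the \<open>n\<close>-th powers is at most \<open>n\<close> times the distance of the bases.\<close>

lemma power_tendsto_exp:
  fixes a :: "nat \<Rightarrow> complex"
  assumes a: "\<forall>\<^sub>F n in sequentially. cmod (a n) \<le> 1" and c: "0 \<le> c"
    and lim: "(\<lambda>n. of_nat n * (a n - 1)) \<longlonglongrightarrow> complex_of_real (- c)"
  shows "(\<lambda>n. a n ^ n) \<longlonglongrightarrow> complex_of_real (exp (- c))"
proof -
  have 1: "(\<lambda>n. complex_of_real ((1 + - c / real n) ^ n)) \<longlonglongrightarrow> complex_of_real (exp (- c))"
    by (intro tendsto_of_real tendsto_exp_limit_sequentially)
  have 2: "\<forall>\<^sub>F n in sequentially. norm (a n ^ n - complex_of_real ((1 + - c / real n) ^ n))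
      \<le> cmod (of_nat n * (a n - 1) - complex_of_real (- c))"
    using a eventually_gt_at_top[of 0] eventually_ge_at_top[of "nat \<lceil>c\<rceil>"]
  proof eventually_elim
    case (elim n)
    then have n: "c \<le> real n" "real n > 0" by linarith+
    then have "\<bar>1 + - c / real n\<bar> \<le> 1" using c by (auto simp: abs_le_iff field_simps)
    then have w: "cmod (complex_of_real (1 + - c / real n)) \<le> 1" by (simp only: norm_of_real)
    have "norm (a n ^ n - complex_of_real (1 + - c / real n) ^ n) \<le>
        n * norm (a n - complex_of_real (1 + - c / real n))"
      by (rule norm_power_diff) (use elim w in auto)
    also have "\<dots> = norm (of_nat n * (a n - complex_of_real (1 + - c / real n)))"
      by (simp add: norm_mult)
    also have "of_nat n * (a n - complex_of_real (1 + - c / real n)) =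
        of_nat n * (a n - 1) - complex_of_real (- c)"
      using n by (simp add: field_simps)
    finally show ?case by simp
  qed
  have 3: "(\<lambda>n. cmod (of_nat n * (a n - 1) - complex_of_real (- c))) \<longlonglongrightarrow> 0"
    using lim by (intro tendsto_norm_zero) (simp only: LIM_zero)
  have "(\<lambda>n. a n ^ n - complex_of_real ((1 + - c / real n) ^ n)) \<longlonglongrightarrow> 0"
    by (rule Lim_null_comparison[OF 2 3])
  from tendsto_add[OF this 1] show ?thesis by simp
qed

section \<open>Normal limits for row sums of independent variables\<close>

lemma char_normal_distribution:
  assumes "0 < \<sigma>"
  shows "char (density lborel (\<lambda>x. ennreal (normal_density 0 \<sigma> x))) t =
    complex_of_real (exp (- (\<sigma>\<^sup>2 * t\<^sup>2 / 2)))"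
proof -
  interpret S: real_distribution std_normal_distribution by (rule real_dist_normal_dist)
  have "distributed std_normal_distribution lborel (\<lambda>x. x) std_normal_density"
    unfolding distributed_def by (auto simp: distr_id2)
  from S.normal_density_affine[OF this, of \<sigma> 0] assms
  have "density lborel (\<lambda>x. ennreal (normal_density 0 \<sigma> x)) =
      distr std_normal_distribution lborel (\<lambda>x. \<sigma> * x)"
    by (simp add: distributed_def)
  then have "char (density lborel (\<lambda>x. ennreal (normal_density 0 \<sigma> x))) t =
      char std_normal_distribution (\<sigma> * t)"
    by (simp add: char_def integral_distr mult_ac)
  then show ?thesis by (simp add: char_std_normal_distribution power_mult_distrib)
qed

text \<open>By independence the row sum has characteristic function \<open>char (\<nu> n) t ^ n\<close>, so by Levy's
  continuity theorem the first-order behaviour of \<open>char (\<nu> n) t - 1\<close> decides the limit law.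
  The rows are described only for large \<open>n\<close>, because dividing by a norming sequence such as
  \<open>sqrt (ln n / n)\<close> makes no sense for the first few of them.\<close>

lemma (in prob_space) weak_conv_normal_row_iid:
  fixes W :: "nat \<Rightarrow> nat \<Rightarrow> 'a \<Rightarrow> real"
  assumes borel: "\<And>n. random_variable borel (S n)"
    and S: "\<forall>\<^sub>F n in sequentially. S n = (\<lambda>\<omega>. \<Sum>i\<in>{1..n}. W n i \<omega>)"
    and indep: "\<forall>\<^sub>F n in sequentially. indep_vars (\<lambda>_. borel) (W n) {1..n}"
    and law: "\<forall>\<^sub>F n in sequentially. \<forall>i\<in>{1..n}. distr M borel (W n i) = \<nu> n"
    and \<sigma>: "0 < \<sigma>"
    and lim: "\<And>t. (\<lambda>n. of_nat n * (char (\<nu> n) t - 1)) \<longlonglongrightarrow> complex_of_real (- (\<sigma>\<^sup>2 * t\<^sup>2 / 2))"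
  shows "weak_conv_m (\<lambda>n. distr M borel (S n)) (density lborel (\<lambda>x. ennreal (normal_density 0 \<sigma> x)))"
proof (rule levy_continuity)
  show "real_distribution (distr M borel (S n))" for n
    by (rule real_distribution_distr) (rule borel)
  interpret N: prob_space "density lborel (\<lambda>x. ennreal (normal_density 0 \<sigma> x))"
    by (rule prob_space_normal_density) (rule \<sigma>)
  show "real_distribution (density lborel (\<lambda>x. ennreal (normal_density 0 \<sigma> x)))"
    by unfold_locales auto
  fix t
  have \<nu>: "\<forall>\<^sub>F n in sequentially. real_distribution (\<nu> n)"
    using indep law eventually_ge_at_top[of 1]
  proof eventually_elim
    case (elim n)
    then have "random_variable borel (W n 1)" "distr M borel (W n 1) = \<nu> n"
      by (auto simp: indep_vars_def2)
    then show ?case using real_distribution_distr[of "W n 1"] by metis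
  qed
  have "\<forall>\<^sub>F n in sequentially. cmod (char (\<nu> n) t) \<le> 1"
    using \<nu> by eventually_elim (rule real_distribution.cmod_char_le_1)
  from power_tendsto_exp[OF this _ lim]
  have "(\<lambda>n. char (\<nu> n) t ^ n) \<longlonglongrightarrow> complex_of_real (exp (- (\<sigma>\<^sup>2 * t\<^sup>2 / 2)))"
    by simp
  moreover have "\<forall>\<^sub>F n in sequentially. char (\<nu> n) t ^ n = char (distr M borel (S n)) t"
    using S indep law
  proof eventually_elim
    case (elim n)
    then show ?case using char_distr_sum[OF elim(2), of t] by simp
  qed
  ultimately show "(\<lambda>n. char (distr M borel (S n)) t) \<longlonglongrightarrow>
      char (density lborel (\<lambda>x. ennreal (normal_density 0 \<sigma> x))) t"
    unfolding char_normal_distribution[OF \<sigma>] by (rule Lim_transform_eventually)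
qed

text \<open>Once multiplied by \<open>n\<close>, the terms of the second-order expansion converge by hypothesis, and its
  error is asymptotically at most \<open>\<delta> \<bar>t\<bar>\<^sup>3 s\<close>, where \<open>\<delta>\<close> is arbitrary.\<close>

lemma char_limit_of_small_array:
  fixes N :: "nat \<Rightarrow> 'a measure" and Z :: "nat \<Rightarrow> 'a \<Rightarrow> real"
  assumes N: "\<forall>\<^sub>F n in sequentially. prob_space (N n)"
    and Z: "\<forall>\<^sub>F n in sequentially. Z n \<in> borel_measurable (N n)"
    and bounded: "\<forall>\<^sub>F n in sequentially. \<forall>x\<in>space (N n). \<bar>Z n x\<bar> \<le> K"
    and mean: "(\<lambda>n. real n * (LINT x|N n. Z n x)) \<longlonglongrightarrow> 0"
    and second: "(\<lambda>n. real n * (LINT x|N n. (Z n x)\<^sup>2)) \<longlonglongrightarrow> s"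
    and small: "\<And>\<delta>. \<delta> > 0 \<Longrightarrow>
      (\<lambda>n. real n * measure (N n) {x \<in> space (N n). \<delta> < \<bar>Z n x\<bar>}) \<longlonglongrightarrow> 0"
  shows "(\<lambda>n. of_nat n * (char (distr (N n) borel (Z n)) t - 1)) \<longlonglongrightarrow> complex_of_real (- (s * t\<^sup>2 / 2))"
proof -
  let ?m = "\<lambda>n. LINT x|N n. Z n x" and ?q = "\<lambda>n. LINT x|N n. (Z n x)\<^sup>2"
  let ?main = "\<lambda>n. \<i> * t * complex_of_real (real n * ?m n) - t\<^sup>2 / 2 * complex_of_real (real n * ?q n)"
  let ?d = "\<lambda>n. of_nat n * (char (distr (N n) borel (Z n)) t - 1) - ?main n"
  have bound: "\<forall>\<^sub>F n in sequentially. cmod (?d n) \<le>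
      t\<^sup>2 * (K\<^sup>2 * (real n * measure (N n) {x \<in> space (N n). \<delta> < \<bar>Z n x\<bar>}) + \<bar>t\<bar> * \<delta> * (real n * ?q n))"
    if "\<delta> > 0" for \<delta>
    using N Z bounded
  proof eventually_elim
    case (elim n)
    interpret prob_space "N n" by fact
    have "?d n = of_nat n * (char (distr (N n) borel (Z n)) t -
        (1 + \<i> * t * ?m n - t\<^sup>2 / 2 * ?q n))"
      by (simp add: algebra_simps)
    then have "cmod (?d n) = real n * cmod (char (distr (N n) borel (Z n)) t -
        (1 + \<i> * t * ?m n - t\<^sup>2 / 2 * ?q n))"
      by (simp only: norm_mult norm_of_nat)
    also have "\<dots> \<le> real n * (t\<^sup>2 * (K\<^sup>2 * prob {x \<in> space (N n). \<delta> < \<bar>Z n x\<bar>} + \<bar>t\<bar> * \<delta> * ?q n))"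
      using elim that by (intro mult_left_mono char_second_order_bound) auto
    finally show ?case by (simp add: algebra_simps)
  qed
  have "?d \<longlonglongrightarrow> 0"
  proof (rule tendstoI)
    fix e :: real assume e: "e > 0"
    \<comment> \<open>The error bound tends to \<open>\<delta> \<bar>t\<bar>\<^sup>3 s\<close>; adding \<open>1\<close> to \<open>C\<close> makes it strictly less than \<open>e\<close>, also when \<open>t = 0\<close>.\<close>
    define C where "C = t\<^sup>2 * \<bar>t\<bar> * \<bar>s\<bar> + 1"
    have C: "C > 0" unfolding C_def by (intro add_nonneg_pos) auto
    define \<delta> where "\<delta> = e / C"
    have \<delta>: "\<delta> > 0" using e C by (simp add: \<delta>_def)
    let ?r = "\<lambda>n. t\<^sup>2 * (K\<^sup>2 * (real n * measure (N n) {x \<in> space (N n). \<delta> < \<bar>Z n x\<bar>}) + \<bar>t\<bar> * \<delta> * (real n * ?q n))"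
    have "?r \<longlonglongrightarrow> t\<^sup>2 * (K\<^sup>2 * 0 + \<bar>t\<bar> * \<delta> * s)"
      by (intro tendsto_intros small second \<delta>)
    moreover have "t\<^sup>2 * (K\<^sup>2 * 0 + \<bar>t\<bar> * \<delta> * s) < e"
    proof -
      have "t\<^sup>2 * (K\<^sup>2 * 0 + \<bar>t\<bar> * \<delta> * s) \<le> \<delta> * (t\<^sup>2 * \<bar>t\<bar> * \<bar>s\<bar>)"
        using \<delta> by (simp add: mult_ac mult_right_mono)
      also have "\<dots> < \<delta> * C" using \<delta> by (simp add: C_def)
      also have "\<dots> = e" using C by (simp add: \<delta>_def)
      finally show ?thesis .
    qed
    ultimately have "\<forall>\<^sub>F n in sequentially. ?r n < e" by (rule order_tendstoD)
    then show "\<forall>\<^sub>F n in sequentially. dist (?d n) 0 < e"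
      using bound[OF \<delta>] by eventually_elim simp
  qed
  moreover have "?main \<longlonglongrightarrow> \<i> * t * complex_of_real 0 - t\<^sup>2 / 2 * complex_of_real s"
    by (intro tendsto_intros mean second)
  ultimately have "(\<lambda>n. ?d n + ?main n) \<longlonglongrightarrow> 0 + (\<i> * t * complex_of_real 0 - t\<^sup>2 / 2 * complex_of_real s)"
    by (rule tendsto_add)
  then show ?thesis by (simp add: mult_ac)
qed

section \<open>Truncation of heavy-tailed rows\<close>

text \<open>The level \<open>b + v\<close> is chosen so that, after centering at the mean \<open>v\<close> of \<open>h\<close> and dividing by
  \<open>b\<close>, the truncated variable is at most \<open>1\<close>. It is centered at the mean of \<open>h\<close> and not at its own
  mean; the resulting bias is exactly the discarded part of the mean.\<close>

lemma (in prob_space) truncated_law: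
  fixes h :: "'a \<Rightarrow> real" and b :: real
  defines "v \<equiv> expectation h"
  defines "u \<equiv> \<lambda>x. h x * indicator {x. h x < b + v} x"
  defines "Z \<equiv> \<lambda>x. (u x - v) / b"
  assumes h [measurable]: "random_variable borel h" and nonneg: "\<And>x. x \<in> space M \<Longrightarrow> 0 \<le> h x"
    and int: "integrable M h" and b: "0 < b"
  shows truncated_borel: "random_variable borel Z"
    and truncated_bounds: "x \<in> space M \<Longrightarrow> - (v / b) \<le> Z x \<and> Z x \<le> 1"
    and truncated_mean: "expectation Z = - (expectation (\<lambda>x. h x * indicator {x. b + v \<le> h x} x) / b)"
    and truncated_second_moment: "\<bar>expectation (\<lambda>x. (Z x)\<^sup>2) -
          expectation (\<lambda>x. (h x)\<^sup>2 * indicator {x. h x < b + v} x) / b\<^sup>2\<bar> \<le> (v / b)\<^sup>2"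
    and truncated_small: "v / b \<le> \<delta> \<Longrightarrow>
          prob {x \<in> space M. \<delta> < \<bar>Z x\<bar>} \<le> prob {x \<in> space M. \<delta> * b \<le> h x}"
    and truncated_neq: "prob {x \<in> space M. (h x - v) / b \<noteq> Z x} \<le> prob {x \<in> space M. b \<le> h x}"
proof -
  have v: "0 \<le> v" unfolding v_def by (intro integral_nonneg_AE AE_I2 nonneg)
  have u [measurable]: "random_variable borel u"
    unfolding u_def by measurable
  show [measurable]: "random_variable borel Z" unfolding Z_def by measurable
  have u0: "0 \<le> u x" "u x \<le> b + v" "u x \<le> h x" if "x \<in> space M" for x
    using nonneg[OF that] v b by (auto simp: u_def indicator_def)
  show bounds: "- (v / b) \<le> Z x \<and> Z x \<le> 1" if "x \<in> space M" for x
    using u0[OF that] b v by (auto simp: Z_def field_simps)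
  have intu: "integrable M u"
    by (rule integrable_const_bound[where B = "b + v"]) (use u0 in \<open>auto intro!: AE_I2\<close>)
  have intu2: "integrable M (\<lambda>x. (u x)\<^sup>2)"
    by (rule integrable_const_bound[where B = "(b + v)\<^sup>2"]) (use u0 in \<open>auto intro!: AE_I2 power_mono\<close>)
  have inttail: "integrable M (\<lambda>x. h x * indicator {x. b + v \<le> h x} x)"
    by (rule Bochner_Integration.integrable_bound[OF int]) (auto simp: indicator_def)
  have "h x = u x + h x * indicator {x. b + v \<le> h x} x" for x
    by (auto simp: u_def indicator_def)
  then have "expectation h = expectation (\<lambda>x. u x + h x * indicator {x. b + v \<le> h x} x)"
    by (intro Bochner_Integration.integral_cong) auto
  then have split: "v = expectation u + expectation (\<lambda>x. h x * indicator {x. b + v \<le> h x} x)"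
    unfolding v_def[symmetric] using intu inttail by simp
  show "expectation Z = - (expectation (\<lambda>x. h x * indicator {x. b + v \<le> h x} x) / b)"
  proof -
    have "expectation Z = (expectation u - v) / b"
      unfolding Z_def using intu by (simp add: prob_space)
    also have "expectation u - v = - expectation (\<lambda>x. h x * indicator {x. b + v \<le> h x} x)"
      using split by linarith
    finally show ?thesis by simp
  qed
  have eu: "0 \<le> expectation u" "expectation u \<le> v"
    unfolding v_def by (auto intro!: integral_nonneg_AE integral_mono u0 intu int)
  have "expectation (\<lambda>x. (Z x)\<^sup>2) = expectation (\<lambda>x. ((u x)\<^sup>2 + (v\<^sup>2 - 2 * v * u x)) / b\<^sup>2)"
    by (intro Bochner_Integration.integral_cong) (auto simp: Z_def power_divide power2_diff)
  also have "\<dots> = (expectation (\<lambda>x. (u x)\<^sup>2) + (v\<^sup>2 - 2 * v * expectation u)) / b\<^sup>2"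
    using intu intu2 by (simp add: prob_space)
  also have "(\<lambda>x. (u x)\<^sup>2) = (\<lambda>x. (h x)\<^sup>2 * indicator {x. h x < b + v} x)"
    by (auto simp: u_def indicator_def)
  finally have "expectation (\<lambda>x. (Z x)\<^sup>2) -
      expectation (\<lambda>x. (h x)\<^sup>2 * indicator {x. h x < b + v} x) / b\<^sup>2 = (v\<^sup>2 - 2 * v * expectation u) / b\<^sup>2"
    by (simp add: add_divide_distrib)
  moreover have "\<bar>v\<^sup>2 - 2 * v * expectation u\<bar> \<le> v\<^sup>2"
  proof -
    have "0 \<le> v * expectation u" "v * expectation u \<le> v * v"
      using eu v by (auto intro: mult_left_mono)
    then show ?thesis by (simp add: abs_le_iff power2_eq_square)
  qed
  ultimately show "\<bar>expectation (\<lambda>x. (Z x)\<^sup>2) -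
      expectation (\<lambda>x. (h x)\<^sup>2 * indicator {x. h x < b + v} x) / b\<^sup>2\<bar> \<le> (v / b)\<^sup>2"
    by (simp add: power_divide divide_right_mono)
  show "prob {x \<in> space M. \<delta> < \<bar>Z x\<bar>} \<le> prob {x \<in> space M. \<delta> * b \<le> h x}" if \<delta>: "v / b \<le> \<delta>"
  proof (rule finite_measure_mono)
    show "{x \<in> space M. \<delta> < \<bar>Z x\<bar>} \<subseteq> {x \<in> space M. \<delta> * b \<le> h x}"
    \<comment> \<open>As \<open>Z \<ge> - (v / b) \<ge> - \<delta>\<close>, a deviation beyond \<open>\<delta>\<close> can only be upwards.\<close>
    proof safe
      fix x assume x: "x \<in> space M" "\<delta> < \<bar>Z x\<bar>"
      then have "\<delta> < Z x" using bounds[of x] \<delta> by linarith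
      then have "\<delta> * b < u x - v" using b by (simp add: Z_def field_simps)
      then show "\<delta> * b \<le> h x" using u0[OF x(1)] v by linarith
    qed
  qed measurable
  show "prob {x \<in> space M. (h x - v) / b \<noteq> Z x} \<le> prob {x \<in> space M. b \<le> h x}"
  proof (rule finite_measure_mono)
    show "{x \<in> space M. (h x - v) / b \<noteq> Z x} \<subseteq> {x \<in> space M. b \<le> h x}"
      using v b by (auto simp: Z_def u_def indicator_def)
  qed measurable
qed

text \<open>A degenerate-convergence criterion for nonnegative rows whose variance may be infinite. The tail
  hypothesis serves twice: with \<open>\<epsilon> = 1\<close> it makes truncation change the law by \<open>o(1/n)\<close>, and for
  small \<open>\<epsilon>\<close> it is the Lindeberg condition for the truncated variables. The other hypotheses
  control their bias and their second moment.\<close>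

lemma char_limit_of_heavy_tailed_array:
  fixes N :: "nat \<Rightarrow> 'a measure" and h :: "nat \<Rightarrow> 'a \<Rightarrow> real" and b v :: "nat \<Rightarrow> real"
  assumes N: "\<forall>\<^sub>F n in sequentially. prob_space (N n)"
    and h: "\<forall>\<^sub>F n in sequentially. h n \<in> borel_measurable (N n)"
    and nonneg: "\<forall>\<^sub>F n in sequentially. \<forall>x\<in>space (N n). 0 \<le> h n x"
    and int: "\<forall>\<^sub>F n in sequentially. integrable (N n) (h n)"
    and mean: "\<forall>\<^sub>F n in sequentially. v n = (LINT x|N n. h n x)"
    and b: "\<forall>\<^sub>F n in sequentially. 0 < b n"
    and mean_small: "(\<lambda>n. real n * (v n / b n)\<^sup>2) \<longlonglongrightarrow> 0"
    and tail: "\<And>\<epsilon>. \<epsilon> > 0 \<Longrightarrow> (\<lambda>n. real n * measure (N n) {x \<in> space (N n). \<epsilon> * b n \<le> h n x}) \<longlonglongrightarrow> 0"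
    and tail_mean: "(\<lambda>n. real n / b n *
       (LINT x|N n. h n x * indicator {x. b n + v n \<le> h n x} x)) \<longlonglongrightarrow> 0"
    and truncated_square: "(\<lambda>n. real n / (b n)\<^sup>2 *
       (LINT x|N n. (h n x)\<^sup>2 * indicator {x. h n x < b n + v n} x)) \<longlonglongrightarrow> s"
  shows "(\<lambda>n. of_nat n * (char (distr (N n) borel (\<lambda>x. (h n x - v n) / b n)) t - 1))
           \<longlonglongrightarrow> complex_of_real (- (s * t\<^sup>2 / 2))"
proof -
  define Z where "Z n x = (h n x * indicator {x. h n x < b n + v n} x - v n) / b n" for n x
  let ?ok = "\<lambda>n. prob_space (N n) \<and> h n \<in> borel_measurable (N n) \<and> (\<forall>x\<in>space (N n). 0 \<le> h n x) \<and>
    integrable (N n) (h n) \<and> v n = (LINT x|N n. h n x) \<and> 0 < b n"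
  have ok: "\<forall>\<^sub>F n in sequentially. ?ok n"
    using N h nonneg int mean b by eventually_elim auto
  have Zborel: "Z n \<in> borel_measurable (N n)"
    and Zbounds: "x \<in> space (N n) \<Longrightarrow> - (v n / b n) \<le> Z n x \<and> Z n x \<le> 1"
    and Zmean: "(LINT x|N n. Z n x) =
        - ((LINT x|N n. h n x * indicator {x. b n + v n \<le> h n x} x) / b n)"
    and Zsecond: "\<bar>(LINT x|N n. (Z n x)\<^sup>2) -
        (LINT x|N n. (h n x)\<^sup>2 * indicator {x. h n x < b n + v n} x) / (b n)\<^sup>2\<bar> \<le> (v n / b n)\<^sup>2"
    and Zsmall: "v n / b n \<le> \<delta> \<Longrightarrow> measure (N n) {x \<in> space (N n). \<delta> < \<bar>Z n x\<bar>}
        \<le> measure (N n) {x \<in> space (N n). \<delta> * b n \<le> h n x}"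
    and Zneq: "measure (N n) {x \<in> space (N n). (h n x - v n) / b n \<noteq> Z n x}
        \<le> measure (N n) {x \<in> space (N n). b n \<le> h n x}"
    if "?ok n" for n x \<delta>
  proof -
    interpret prob_space "N n" using that by simp
    have *: "(LINT x|N n. h n x) = v n" and **: "h n \<in> borel_measurable (N n)"
      "\<And>x. x \<in> space (N n) \<Longrightarrow> 0 \<le> h n x" "integrable (N n) (h n)" "0 < b n"
      using that by auto
    have Z: "Z n = (\<lambda>x. (h n x * indicator {x. h n x < b n + v n} x - v n) / b n)"
      by (simp add: Z_def fun_eq_iff)
    note facts = truncated_borel[OF **] truncated_bounds[OF **] truncated_mean[OF **]
      truncated_second_moment[OF **] truncated_small[OF **] truncated_neq[OF **]
    note facts' = facts[unfolded *, folded Z_def, folded Z]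
    show "Z n \<in> borel_measurable (N n)" by (rule facts')
    show "x \<in> space (N n) \<Longrightarrow> - (v n / b n) \<le> Z n x \<and> Z n x \<le> 1" by (rule facts')
    show "(LINT x|N n. Z n x) =
        - ((LINT x|N n. h n x * indicator {x. b n + v n \<le> h n x} x) / b n)" by (rule facts')
    show "\<bar>(LINT x|N n. (Z n x)\<^sup>2) -
        (LINT x|N n. (h n x)\<^sup>2 * indicator {x. h n x < b n + v n} x) / (b n)\<^sup>2\<bar> \<le> (v n / b n)\<^sup>2"
      by (rule facts')
    show "v n / b n \<le> \<delta> \<Longrightarrow> measure (N n) {x \<in> space (N n). \<delta> < \<bar>Z n x\<bar>}
        \<le> measure (N n) {x \<in> space (N n). \<delta> * b n \<le> h n x}" by (rule facts')
    show "measure (N n) {x \<in> space (N n). (h n x - v n) / b n \<noteq> Z n x}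
        \<le> measure (N n) {x \<in> space (N n). b n \<le> h n x}" by (rule facts')
  qed
  \<comment> \<open>Since \<open>(v n / b n)\<^sup>2 \<le> n (v n / b n)\<^sup>2\<close>, the means vanish after normalisation.\<close>
  have small_ratio: "\<forall>\<^sub>F n in sequentially. v n / b n \<le> \<delta>" if "\<delta> > 0" for \<delta>
  proof -
    have "\<forall>\<^sub>F n in sequentially. real n * (v n / b n)\<^sup>2 < \<delta>\<^sup>2"
      using order_tendstoD(2)[OF mean_small, of "\<delta>\<^sup>2"] that by simp
    then show ?thesis using eventually_ge_at_top[of 1]
    proof eventually_elim
      case (elim n)
      have "(v n / b n)\<^sup>2 * 1 \<le> (v n / b n)\<^sup>2 * real n"
        using elim by (intro mult_left_mono) auto
      then have "(v n / b n)\<^sup>2 \<le> \<delta>\<^sup>2" using elim by (simp add: mult_ac)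
      then show ?case by (rule power2_le_imp_le) (use that in simp)
    qed
  qed
  have limZ: "(\<lambda>n. of_nat n * (char (distr (N n) borel (Z n)) t - 1)) \<longlonglongrightarrow> complex_of_real (- (s * t\<^sup>2 / 2))"
  proof (rule char_limit_of_small_array[where K = 1])
    show "\<forall>\<^sub>F n in sequentially. prob_space (N n)" by (rule N)
    show "\<forall>\<^sub>F n in sequentially. Z n \<in> borel_measurable (N n)"
      using ok by eventually_elim (rule Zborel)
    show "\<forall>\<^sub>F n in sequentially. \<forall>x\<in>space (N n). \<bar>Z n x\<bar> \<le> 1"
      using ok small_ratio[OF zero_less_one]
    proof eventually_elim
      case (elim n)
      show ?case
      proof
        fix x assume "x \<in> space (N n)"
        from Zbounds[OF elim(1) this] elim(2) show "\<bar>Z n x\<bar> \<le> 1" by linarith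
      qed
    qed
    have "\<forall>\<^sub>F n in sequentially. - (real n / b n *
        (LINT x|N n. h n x * indicator {x. b n + v n \<le> h n x} x)) = real n * (LINT x|N n. Z n x)"
      using ok by eventually_elim (simp add: Zmean)
    with tendsto_minus[OF tail_mean] show "(\<lambda>n. real n * (LINT x|N n. Z n x)) \<longlonglongrightarrow> 0"
      by (simp add: Lim_transform_eventually)
    let ?q = "\<lambda>n. real n / (b n)\<^sup>2 * (LINT x|N n. (h n x)\<^sup>2 * indicator {x. h n x < b n + v n} x)"
    have "\<forall>\<^sub>F n in sequentially. norm (real n * (LINT x|N n. (Z n x)\<^sup>2) - ?q n) \<le> real n * (v n / b n)\<^sup>2"
      using ok
    proof eventually_elim
      case (elim n)
      have "real n * (LINT x|N n. (Z n x)\<^sup>2) - ?q n = real n * ((LINT x|N n. (Z n x)\<^sup>2) -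
        (LINT x|N n. (h n x)\<^sup>2 * indicator {x. h n x < b n + v n} x) / (b n)\<^sup>2)"
        by (simp add: algebra_simps)
      then have "norm (real n * (LINT x|N n. (Z n x)\<^sup>2) - ?q n) = real n * \<bar>(LINT x|N n. (Z n x)\<^sup>2) -
        (LINT x|N n. (h n x)\<^sup>2 * indicator {x. h n x < b n + v n} x) / (b n)\<^sup>2\<bar>"
        by (simp only: real_norm_def abs_mult abs_of_nat)
      also have "\<dots> \<le> real n * (v n / b n)\<^sup>2"
        by (intro mult_left_mono Zsecond elim) auto
      finally show ?case .
    qed
    from Lim_null_comparison[OF this mean_small]
    have "(\<lambda>n. real n * (LINT x|N n. (Z n x)\<^sup>2) - ?q n) \<longlonglongrightarrow> 0" .
    from tendsto_add[OF this truncated_square]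
    show "(\<lambda>n. real n * (LINT x|N n. (Z n x)\<^sup>2)) \<longlonglongrightarrow> s" by simp
    fix \<delta> :: real assume \<delta>: "\<delta> > 0"
    show "(\<lambda>n. real n * measure (N n) {x \<in> space (N n). \<delta> < \<bar>Z n x\<bar>}) \<longlonglongrightarrow> 0"
    proof (rule Lim_null_comparison[OF _ tail[OF \<delta>]])
      show "\<forall>\<^sub>F n in sequentially. norm (real n * measure (N n) {x \<in> space (N n). \<delta> < \<bar>Z n x\<bar>})
          \<le> real n * measure (N n) {x \<in> space (N n). \<delta> * b n \<le> h n x}"
        using ok small_ratio[OF \<delta>] by eventually_elim (simp add: Zsmall mult_left_mono)
    qed
  qed
  let ?W = "\<lambda>n x. (h n x - v n) / b n"
  have "(\<lambda>n. of_nat n * (char (distr (N n) borel (?W n)) t - 1) -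
      of_nat n * (char (distr (N n) borel (Z n)) t - 1)) \<longlonglongrightarrow> 0"
  proof (rule Lim_null_comparison)
    show "(\<lambda>n. 2 * (real n * measure (N n) {x \<in> space (N n). b n \<le> h n x})) \<longlonglongrightarrow> 0"
      using tail[OF zero_less_one] by (intro tendsto_mult_right_zero) simp
    show "\<forall>\<^sub>F n in sequentially. norm (of_nat n * (char (distr (N n) borel (?W n)) t - 1) -
        of_nat n * (char (distr (N n) borel (Z n)) t - 1))
        \<le> 2 * (real n * measure (N n) {x \<in> space (N n). b n \<le> h n x})"
      using ok
    proof eventually_elim
      case (elim n)
      then interpret prob_space "N n" by simp
      have [measurable]: "h n \<in> borel_measurable (N n)" using elim by simp
      have "norm (of_nat n * (char (distr (N n) borel (?W n)) t - 1) -
          of_nat n * (char (distr (N n) borel (Z n)) t - 1)) =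
          norm (of_nat n * (char (distr (N n) borel (?W n)) t - char (distr (N n) borel (Z n)) t))"
        by (simp add: algebra_simps)
      also have "\<dots> = real n * cmod (char (distr (N n) borel (?W n)) t - char (distr (N n) borel (Z n)) t)"
        by (simp add: norm_mult)
      also have "\<dots> \<le> real n * (2 * prob {x \<in> space (N n). ?W n x \<noteq> Z n x})"
        by (intro mult_left_mono cmod_char_diff_le_prob_neq Zborel[OF elim]) auto
      also have "\<dots> \<le> real n * (2 * prob {x \<in> space (N n). b n \<le> h n x})"
        by (intro mult_left_mono Zneq[OF elim]) auto
      finally show ?case by simp
    qed
  qed
  from tendsto_add[OF this limZ] show ?thesis by simp
qed

section \<open>Quantile transforms of uniform variables\<close>

lemma real_distribution_of_df:
  assumes "distribution_function_nonneg F"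
  shows "real_distribution (interval_measure F)" and "cdf (interval_measure F) = F"
proof -
  have 1: "mono F" "\<And>x. continuous (at_right x) F" "(F \<longlongrightarrow> 1) at_top"
    and 2: "\<And>x. x < 0 \<Longrightarrow> F x = 0"
    using assms by (auto simp: distribution_function_nonneg_def)
  have "\<forall>\<^sub>F x in at_bot. F x = 0"
    using eventually_gt_at_bot[of 0] by eventually_elim (rule 2)
  then have 3: "(F \<longlongrightarrow> 0) at_bot" by (rule tendsto_eventually)
  show "real_distribution (interval_measure F)"
    by (rule real_distribution_interval_measure) (use 1 3 in \<open>auto dest: monoD\<close>)
  show "cdf (interval_measure F) = F"
    by (rule cdf_interval_measure) (use 1 3 in \<open>auto dest: monoD\<close>)
qed

text \<open>The quantile function is monotone on \<open>(0, 1)\<close>, but possibly not beyond. Outside this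
  interval it takes at most three values: the infimum is over all reals for \<open>u \<le> 0\<close> and over the empty set for \<open>u > 1\<close>, and
  \<open>u = 1\<close> is a single point.\<close>

lemma borel_measurable_quantile:
  assumes "distribution_function_nonneg F"
  shows "quantile F \<in> borel_measurable borel"
proof -
  interpret cdf_distribution "interval_measure F"
    unfolding cdf_distribution_def by (rule real_distribution_of_df(1)[OF assms])
  note F = real_distribution_of_df(2)[OF assms]
  have q: "quantile F = I" by (simp add: F quantile_def fun_eq_iff)
  have F01: "0 \<le> F x" "F x \<le> 1" for x
    using cdf_nonneg[of x] cdf_bounded_prob[of x] by (simp_all add: F)
  have low: "quantile F u = Inf UNIV" if "u \<le> 0" for u
  proof -
    have "{x. u \<le> F x} = UNIV" using F01 that order_trans by blast
    then show ?thesis by (simp add: quantile_def)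
  qed
  have high: "quantile F u = Inf {}" if "u > 1" for u
  proof -
    have "{x. u \<le> F x} = {}" using F01(2) that by (auto simp: not_le intro: le_less_trans)
    then show ?thesis by (simp add: quantile_def)
  qed
  have inner: "(\<lambda>u. if u \<in> {0<..<1} then quantile F u else 0) \<in> borel_measurable borel"
    by (subst measurable_restrict_space_iff[symmetric]) (use measurable_CI in \<open>auto simp: q\<close>)
  have "quantile F = (\<lambda>u. if u \<le> 0 then Inf UNIV else if u > 1 then Inf {} else
      if u = 1 then quantile F 1 else if u \<in> {0<..<1} then quantile F u else 0)"
    by (auto simp: fun_eq_iff low high)
  also have "\<dots> \<in> borel_measurable borel"
    using inner by measurable
  finally show ?thesis .
qed

lemma (in prob_space) distr_quantile_uniform:
  assumes F: "distribution_function_nonneg F"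
    and T: "distributed M lborel T (indicator {0<..<1})"
  shows "distr M borel (\<lambda>\<omega>. quantile F (T \<omega>)) = interval_measure F"
proof -
  interpret D: cdf_distribution "interval_measure F"
    unfolding cdf_distribution_def by (rule real_distribution_of_df(1)[OF F])
  have q: "quantile F = D.I" by (simp add: real_distribution_of_df(2)[OF F] quantile_def fun_eq_iff)
  note [measurable] = borel_measurable_quantile[OF F]
  have [measurable]: "random_variable borel T" using T by (simp add: distributed_def)
  have law: "distr M lborel T = density lborel (indicator {0<..<1})"
    using T by (simp add: distributed_def)
  have "distr M borel (\<lambda>\<omega>. quantile F (T \<omega>)) = distr (distr M lborel T) borel (quantile F)"
    by (subst distr_distr) (auto simp: comp_def)
  also have "\<dots> = distr (restrict_space lborel {0<..<1}) borel (quantile F)"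
  proof (rule measure_eqI)
    fix A assume "A \<in> sets (distr (distr M lborel T) borel (quantile F))"
    then have A [measurable]: "A \<in> sets borel" by simp
    have vimage [measurable]: "quantile F -` A \<in> sets borel"
      by (rule measurable_sets_borel[OF borel_measurable_quantile[OF F] A])
    have m: "quantile F \<in> restrict_space lborel {0<..<1} \<rightarrow>\<^sub>M borel"
      by (rule measurable_restrict_space1) simp
    have "emeasure (distr (distr M lborel T) borel (quantile F)) A =
        (\<integral>\<^sup>+x. indicator {0<..<1} x * indicator (quantile F -` A) x \<partial>lborel)"
      unfolding law by (subst emeasure_distr) (auto simp: emeasure_density vimage)
    also have "\<dots> = (\<integral>\<^sup>+x. indicator (quantile F -` A \<inter> {0<..<1}) x \<partial>lborel)"
      by (intro nn_integral_cong) (auto simp: indicator_def)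
    also have "\<dots> = emeasure lborel (quantile F -` A \<inter> {0<..<1})"
      by (subst nn_integral_indicator) auto
    also have "\<dots> = emeasure (distr (restrict_space lborel {0<..<1}) borel (quantile F)) A"
      by (simp add: emeasure_distr m emeasure_restrict_space space_restrict_space)
    finally show "emeasure (distr (distr M lborel T) borel (quantile F)) A =
        emeasure (distr (restrict_space lborel {0<..<1}) borel (quantile F)) A" .
  qed simp
  also have "\<dots> = interval_measure F" unfolding q by (rule D.distr_I_eq_M)
  finally show ?thesis .
qed

section \<open>The kernel of the Abel transform\<close>

definition abel_kernel :: "real \<Rightarrow> real \<Rightarrow> real" where
  "abel_kernel x y = (if x < y then 1 / sqrt (y - x) else 0)"

lemma abel_kernel_nonneg: "0 \<le> abel_kernel x y"
  by (simp add: abel_kernel_def)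

lemma borel_measurable_abel_kernel [measurable]: "abel_kernel x \<in> borel_measurable borel"
  unfolding abel_kernel_def by measurable

lemma abel_kernel_square: "(abel_kernel x y)\<^sup>2 = (if x < y then 1 / (y - x) else 0)"
  by (simp add: abel_kernel_def power_divide)

text \<open>Large values of the kernel are taken close to \<open>x\<close>. This turns conditions on the mass and
  moments of a distribution near \<open>x\<close> into tail conditions on the kernel.\<close>

lemma le_abel_kernel_iff:
  assumes "0 < a"
  shows "a \<le> abel_kernel x y \<longleftrightarrow> y \<in> {x<..x + 1 / a\<^sup>2}"
proof (cases "x < y")
  case True
  have "a \<le> abel_kernel x y \<longleftrightarrow> a\<^sup>2 \<le> (abel_kernel x y)\<^sup>2"
    using assms abel_kernel_nonneg[of x y] by (simp add: power2_le_iff_abs_le)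
  also have "\<dots> \<longleftrightarrow> y - x \<le> 1 / a\<^sup>2"
    using True assms by (simp add: abel_kernel_square field_simps)
  finally show ?thesis using True by auto
qed (use assms in \<open>auto simp: abel_kernel_def\<close>)

lemma V_sharp_eq_sum:
  "V_sharp n Y x = (\<Sum>i\<in>{1..n}. abel_kernel x (Y i)) / real n"
proof -
  have "(\<Sum>i\<in>{i\<in>{1..n}. Y i > x}. 1 / sqrt (Y i - x)) = (\<Sum>i\<in>{1..n}. abel_kernel x (Y i))"
    by (subst sum.inter_filter) (auto simp: abel_kernel_def)
  then show ?thesis by (simp add: V_sharp_def)
qed

lemma real_mult_eps_seq: "real n * eps_seq n = sqrt (real n * ln (real n))"
proof -
  have "real n * eps_seq n = real n / sqrt (real n) * sqrt (ln (real n))"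
    by (simp add: eps_seq_def real_sqrt_divide)
  then show ?thesis by (simp add: real_div_sqrt real_sqrt_mult)
qed

lemma V_real_eq_integral:
  assumes "V_ext F x < top"
  shows "integrable (interval_measure F) (abel_kernel x)"
    and "V_real F x = (LINT y|interval_measure F. abel_kernel x y)"
proof -
  have V: "V_ext F x = (\<integral>\<^sup>+y. ennreal (abel_kernel x y) \<partial>interval_measure F)"
    unfolding V_ext_def by (intro nn_integral_cong) (auto simp: abel_kernel_def indicator_def)
  show "integrable (interval_measure F) (abel_kernel x)"
    by (rule integrableI_nonneg) (use assms in \<open>auto simp: V abel_kernel_nonneg\<close>)
  show "V_real F x = (LINT y|interval_measure F. abel_kernel x y)"
    by (subst integral_eq_nn_integral) (auto simp: V_real_def V abel_kernel_nonneg)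
qed

text \<open>The hypotheses on \<open>G\<close> are those of the criterion for heavy-tailed rows in disguise, with \<open>h\<close> the
  kernel and \<open>b n = sqrt (n ln n)\<close>: the interval of length \<open>c_seq G x n\<close> to the right of \<open>x\<close> is where the
  kernel reaches the truncation level, and the factors \<open>1 / eps_seq n\<close> and \<open>1 / ln n\<close> are
  \<open>n / b n\<close> and \<open>n / (b n)\<^sup>2\<close>. Since \<open>V_real (G n) x\<close> stays bounded, centering contributes only
  \<open>O(1 / ln n)\<close> to the normalised second moment.\<close>

lemma char_limit_abel_kernel:
  fixes G :: "nat \<Rightarrow> real \<Rightarrow> real" and x s :: real
  defines "b \<equiv> \<lambda>n. sqrt (real n * ln (real n))"
  assumes G: "\<And>n. n \<ge> 1 \<Longrightarrow> distribution_function_nonneg (G n)"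
    and cond1: "(\<lambda>n. V_ext (G n) x) \<longlonglongrightarrow> ennreal L"
    and cond2: "\<And>\<epsilon>::real. \<epsilon> > 0 \<Longrightarrow>
           (\<lambda>n. real n * (G n (x + 1 / (\<epsilon>\<^sup>2 * real n * ln (real n))) - G n x)) \<longlonglongrightarrow> 0"
    and cond3: "(\<lambda>n. LINT y:{x<..x + c_seq G x n}|interval_measure (G n). 1 / sqrt (y - x))
           \<in> o(\<lambda>n. eps_seq n)"
    and cond4: "(\<lambda>n. 1 / ln (real n) *
           (LINT y:{x + c_seq G x n<..}|interval_measure (G n). 1 / (y - x))) \<longlonglongrightarrow> s"
  shows "(\<lambda>n. of_nat n * (char (distr (interval_measure (G n)) borel
             (\<lambda>y. (abel_kernel x y - V_real (G n) x) / b n)) t - 1))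
           \<longlonglongrightarrow> complex_of_real (- (s * t\<^sup>2 / 2))"
proof (rule char_limit_of_heavy_tailed_array)
  let ?N = "\<lambda>n. interval_measure (G n)" and ?v = "\<lambda>n. V_real (G n) x"
  have large: "\<forall>\<^sub>F n in sequentially. 2 \<le> n" by (rule eventually_ge_at_top)
  have ln_pos: "0 < ln (real n)" and b_pos: "0 < b n" and b_sq: "(b n)\<^sup>2 = real n * ln (real n)"
    if "2 \<le> n" for n
  proof -
    show "0 < ln (real n)" using that by (intro ln_gt_zero) simp
    then show "0 < b n" "(b n)\<^sup>2 = real n * ln (real n)" using that by (auto simp: b_def)
  qed
  have v_nonneg: "0 \<le> ?v n" for n by (simp add: V_real_def)
  have c_eq: "c_seq G x n = 1 / (b n + ?v n)\<^sup>2" for n by (simp add: c_seq_def b_def)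
  have finite: "\<forall>\<^sub>F n in sequentially. V_ext (G n) x < top"
    using cond1 by (rule order_tendstoD) simp
  have v_lim: "?v \<longlonglongrightarrow> max 0 L"
    unfolding V_real_def by (rule tendsto_enn2real) (use cond1 in \<open>simp_all add: ennreal_max_0\<close>)
  have ln_lim: "filterlim (\<lambda>n. ln (real n)) at_top sequentially"
    by (rule filterlim_compose[OF ln_at_top filterlim_real_sequentially])
  show "\<forall>\<^sub>F n in sequentially. prob_space (?N n)"
    using large by eventually_elim
      (metis G real_distribution_of_df(1) real_distribution.axioms(1) one_le_numeral order_trans)
  show "\<forall>\<^sub>F n in sequentially. abel_kernel x \<in> borel_measurable (?N n)"
    by (intro always_eventually allI) measurable
  show "\<forall>\<^sub>F n in sequentially. \<forall>y\<in>space (?N n). 0 \<le> abel_kernel x y"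
    by (simp add: abel_kernel_nonneg)
  show "\<forall>\<^sub>F n in sequentially. integrable (?N n) (abel_kernel x)"
    using finite by eventually_elim (rule V_real_eq_integral)
  show "\<forall>\<^sub>F n in sequentially. ?v n = (LINT y|?N n. abel_kernel x y)"
    using finite by eventually_elim (rule V_real_eq_integral)
  show "\<forall>\<^sub>F n in sequentially. 0 < b n"
    using large by eventually_elim (rule b_pos)
  show "(\<lambda>n. real n * (?v n / b n)\<^sup>2) \<longlonglongrightarrow> 0"
  proof (rule Lim_transform_eventually)
    show "(\<lambda>n. (?v n)\<^sup>2 / ln (real n)) \<longlonglongrightarrow> 0"
      by (rule tendsto_divide_0[OF tendsto_power[OF v_lim]
          filterlim_at_top_imp_at_infinity[OF ln_lim]])
    show "\<forall>\<^sub>F n in sequentially. (?v n)\<^sup>2 / ln (real n) = real n * (?v n / b n)\<^sup>2"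
      using large by eventually_elim (use b_sq in \<open>auto simp: power_divide\<close>)
  qed
  show "(\<lambda>n. real n * measure (?N n) {y \<in> space (?N n). \<epsilon> * b n \<le> abel_kernel x y}) \<longlonglongrightarrow> 0"
    if \<epsilon>: "\<epsilon> > 0" for \<epsilon>
  proof (rule Lim_transform_eventually[OF cond2[OF \<epsilon>]])
    show "\<forall>\<^sub>F n in sequentially. real n * (G n (x + 1 / (\<epsilon>\<^sup>2 * real n * ln (real n))) - G n x) =
        real n * measure (?N n) {y \<in> space (?N n). \<epsilon> * b n \<le> abel_kernel x y}"
      using large
    proof eventually_elim
      case (elim n)
      have df: "distribution_function_nonneg (G n)" using elim by (intro G) simp
      have "{y \<in> space (?N n). \<epsilon> * b n \<le> abel_kernel x y} = {x<..x + 1 / (\<epsilon>\<^sup>2 * real n * ln (real n))}"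
        using \<epsilon> b_pos[OF elim] b_sq[OF elim]
        by (auto simp: le_abel_kernel_iff power_mult_distrib mult.assoc)
      moreover have "0 \<le> 1 / (\<epsilon>\<^sup>2 * real n * ln (real n))" using ln_pos[OF elim] by simp
      ultimately show ?case
        using df by (simp add: measure_interval_measure_Ioc distribution_function_nonneg_def monoD)
    qed
  qed
  show "(\<lambda>n. real n / b n * (LINT y|?N n. abel_kernel x y *
      indicator {y. b n + ?v n \<le> abel_kernel x y} y)) \<longlonglongrightarrow> 0"
  proof (rule Lim_transform_eventually[OF smalloD_tendsto[OF cond3]])
    show "\<forall>\<^sub>F n in sequentially.
        (LINT y:{x<..x + c_seq G x n}|?N n. 1 / sqrt (y - x)) / eps_seq n =
        real n / b n * (LINT y|?N n. abel_kernel x y * indicator {y. b n + ?v n \<le> abel_kernel x y} y)"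
      using large
    proof eventually_elim
      case (elim n)
      have pos: "0 < b n + ?v n" using b_pos[OF elim] v_nonneg[of n] by simp
      have "(LINT y:{x<..x + c_seq G x n}|?N n. 1 / sqrt (y - x)) =
          (LINT y|?N n. abel_kernel x y * indicator {y. b n + ?v n \<le> abel_kernel x y} y)"
        unfolding set_lebesgue_integral_def le_abel_kernel_iff[OF pos] c_eq
        by (intro Bochner_Integration.integral_cong) (auto simp: abel_kernel_def indicator_def)
      moreover have "b n = real n * eps_seq n" by (simp add: b_def real_mult_eps_seq)
      ultimately show ?case using elim by simp
    qed
  qed
  show "(\<lambda>n. real n / (b n)\<^sup>2 * (LINT y|?N n. (abel_kernel x y)\<^sup>2 *
      indicator {y. abel_kernel x y < b n + ?v n} y)) \<longlonglongrightarrow> s"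
  proof (rule Lim_transform_eventually[OF cond4])
    show "\<forall>\<^sub>F n in sequentially. 1 / ln (real n) *
        (LINT y:{x + c_seq G x n<..}|?N n. 1 / (y - x)) =
        real n / (b n)\<^sup>2 * (LINT y|?N n. (abel_kernel x y)\<^sup>2 *
          indicator {y. abel_kernel x y < b n + ?v n} y)"
      using large
    proof eventually_elim
      case (elim n)
      have pos: "0 < b n + ?v n" using b_pos[OF elim] v_nonneg[of n] by simp
      define c where "c = c_seq G x n"
      have "0 < c" using pos by (simp add: c_def c_eq)
      have below: "abel_kernel x y < b n + ?v n \<longleftrightarrow> y \<le> x \<or> x + c < y" for y
        using le_abel_kernel_iff[OF pos, of x y] by (auto simp: c_def c_eq)
      have "(LINT y:{x + c_seq G x n<..}|?N n. 1 / (y - x)) =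
          (LINT y|?N n. (abel_kernel x y)\<^sup>2 * indicator {y. abel_kernel x y < b n + ?v n} y)"
        unfolding set_lebesgue_integral_def c_def[symmetric] below abel_kernel_square
        by (intro Bochner_Integration.integral_cong)
          (use \<open>0 < c\<close> in \<open>auto simp: indicator_def\<close>)
      then show ?case using elim by (simp add: b_sq)
    qed
  qed
qed

theorem proposition2p1:
  fixes P :: "'b measure" and X :: "'b \<Rightarrow> real ^ 3" and \<rho> :: "real \<Rightarrow> real"
    and M :: "'a measure" and T :: "nat \<Rightarrow> 'a \<Rightarrow> real"
    and G :: "nat \<Rightarrow> real \<Rightarrow> real" and x0 :: real
  assumes P: "prob_space P"
    and rho_nonneg: "\<And>z. z \<ge> 0 \<Longrightarrow> \<rho> z \<ge> 0"
    and X_density: "distributed P lborel X (\<lambda>x. ennreal (\<rho> ((x $ 1)\<^sup>2 + (x $ 2)\<^sup>2 + (x $ 3)\<^sup>2)))"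
    and M: "prob_space M"
    and T_indep: "prob_space.indep_vars M (\<lambda>_. borel) T {1..}"
    and T_uniform: "\<And>i. i \<ge> 1 \<Longrightarrow> distributed M lborel (T i) (indicator {0<..<1})"
    and G_df: "\<And>n. n \<ge> 1 \<Longrightarrow> distribution_function_nonneg (G n)"
    and x0_pos: "x0 > 0"
    and g_pos: "dens_g \<rho> x0 > 0"
    and cond1: "(\<lambda>n. V_ext (G n) x0) \<longlonglongrightarrow> ennreal (abel_V \<rho> x0)"
    and cond2: "\<And>\<epsilon>::real. \<epsilon> > 0 \<Longrightarrow>
           (\<lambda>n. real n * (G n (x0 + 1 / (\<epsilon>\<^sup>2 * real n * ln (real n))) - G n x0)) \<longlonglongrightarrow> 0"
    and cond3: "(\<lambda>n. LINT y:{x0<..x0 + c_seq G x0 n}|interval_measure (G n). 1 / sqrt (y - x0))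
           \<in> o(\<lambda>n. eps_seq n)"
    and cond4: "(\<lambda>n. 1 / ln (real n) *
           (LINT y:{x0 + c_seq G x0 n<..}|interval_measure (G n). 1 / (y - x0)))
           \<longlonglongrightarrow> dens_g \<rho> x0"
  shows "weak_conv_m
           (\<lambda>n. distr M borel (\<lambda>\<omega>.
              (V_sharp n (\<lambda>i. quantile (G n) (T i \<omega>)) x0 - V_real (G n) x0) / eps_seq n))
           (density lborel (\<lambda>x. ennreal (normal_density 0 (sqrt (dens_g \<rho> x0)) x)))"
proof -
  interpret prob_space M by (rule M)
  define b where "b n = sqrt (real n * ln (real n))" for n :: nat
  define W where "W n i \<omega> = (abel_kernel x0 (quantile (G n) (T i \<omega>)) - V_real (G n) x0) / b n"
    for n i \<omega>
  have T_borel [measurable]: "random_variable borel (T i)" if "i \<ge> 1" for i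
    using T_uniform[OF that] by (simp add: distributed_def)
  have Y_borel: "random_variable borel (\<lambda>\<omega>. quantile (G n) (T i \<omega>))" if "n \<ge> 1" "i \<ge> 1" for n i
    using measurable_compose[OF T_borel borel_measurable_quantile[OF G_df]] that by blast
  show ?thesis
  proof (rule weak_conv_normal_row_iid[where W = W])
    show "random_variable borel (\<lambda>\<omega>.
        (V_sharp n (\<lambda>i. quantile (G n) (T i \<omega>)) x0 - V_real (G n) x0) / eps_seq n)" for n
      unfolding V_sharp_eq_sum
      by (intro borel_measurable_divide borel_measurable_diff borel_measurable_sum
          borel_measurable_const measurable_compose[OF Y_borel borel_measurable_abel_kernel]) auto
    show "\<forall>\<^sub>F n in sequentially. (\<lambda>\<omega>.
        (V_sharp n (\<lambda>i. quantile (G n) (T i \<omega>)) x0 - V_real (G n) x0) / eps_seq n) =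
        (\<lambda>\<omega>. \<Sum>i\<in>{1..n}. W n i \<omega>)"
      using eventually_ge_at_top[of 1]
    proof eventually_elim
      case (elim n)
      have b: "b n = real n * eps_seq n" by (simp add: b_def real_mult_eps_seq)
      show ?case
      proof
        fix \<omega>
        have "(\<Sum>i\<in>{1..n}. W n i \<omega>) =
            ((\<Sum>i\<in>{1..n}. abel_kernel x0 (quantile (G n) (T i \<omega>))) - real n * V_real (G n) x0) / b n"
          by (simp add: W_def sum_divide_distrib[symmetric] sum_subtractf)
        also have "\<dots> = (V_sharp n (\<lambda>i. quantile (G n) (T i \<omega>)) x0 - V_real (G n) x0) / eps_seq n"
          using elim by (simp add: V_sharp_eq_sum b divide_simps)
        finally show "(V_sharp n (\<lambda>i. quantile (G n) (T i \<omega>)) x0 - V_real (G n) x0) / eps_seq n =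
            (\<Sum>i\<in>{1..n}. W n i \<omega>)" ..
      qed
    qed
    show "\<forall>\<^sub>F n in sequentially. indep_vars (\<lambda>_. borel) (W n) {1..n}"
      using eventually_ge_at_top[of 1]
    proof eventually_elim
      case (elim n)
      note [measurable] = borel_measurable_quantile[OF G_df[OF elim]]
      have "indep_vars (\<lambda>_. borel) T {1..n}"
        by (rule indep_vars_subset[OF T_indep]) auto
      then show ?case
        unfolding W_def by (rule indep_vars_compose2) measurable
    qed
    show "\<forall>\<^sub>F n in sequentially. \<forall>i\<in>{1..n}. distr M borel (W n i) =
        distr (interval_measure (G n)) borel (\<lambda>y. (abel_kernel x0 y - V_real (G n) x0) / b n)"
      using eventually_ge_at_top[of 1]
    proof eventually_elim
      case (elim n)
      show ?case
      proof
        fix i assume i: "i \<in> {1..n}"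
        let ?w = "\<lambda>y. (abel_kernel x0 y - V_real (G n) x0) / b n"
        have "distr M borel (W n i) = distr (distr M borel (\<lambda>\<omega>. quantile (G n) (T i \<omega>))) borel ?w"
          using i elim Y_borel[of n i] by (subst distr_distr) (auto simp: comp_def W_def[abs_def])
        then show "distr M borel (W n i) = distr (interval_measure (G n)) borel ?w"
          using i elim by (simp add: distr_quantile_uniform[OF G_df T_uniform])
      qed
    qed
    show "0 < sqrt (dens_g \<rho> x0)" using g_pos by simp
    show "(\<lambda>n. of_nat n * (char (distr (interval_measure (G n)) borel
             (\<lambda>y. (abel_kernel x0 y - V_real (G n) x0) / b n)) t - 1))
        \<longlonglongrightarrow> complex_of_real (- ((sqrt (dens_g \<rho> x0))\<^sup>2 * t\<^sup>2 / 2))" for t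
      using char_limit_abel_kernel[OF G_df cond1 cond2 cond3 cond4, of t] g_pos
      by (simp add: b_def)
  qed
qed

end
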